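(* Let $\mathbb{K}$ be an algebraically closed field of characteristic $\neq 2$ and let $\alpha_1,\alpha_2\in\mathbb{K}$. The algebra $\mathcal{D}_3(\alpha_1,\alpha_2)$ is semisimple if and only if $$(3\alpha_1-\alpha_2)(\alpha_1+\alpha_2)\neq 0.$$ In this case $\mathcal{D}_3(\alpha_1,\alpha_2)\simeq \left(\mathbb{K}^{2\times 2}\right)^3$ as algebras.
   Context: $\mathcal{D}_3(\alpha_1,\alpha_2)$ denotes the associative unital $\mathbb{K}$-algebra given by generators $a,b,c$ and relations $$a^2=b^2=c^2=\alpha_1,\qquad ca+bc+ab=\alpha_2,\qquad cb+ba+ac=\alpha_2.$$ $\mathbb{K}^{2\times 2}$ is the algebra of $2\times 2$ matrices over $\mathbb{K}$, and $(\mathbb{K}^{2\times 2})^3$ is the direct product of three copies of it. *)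

theory Defs
  imports
    "HOL-Library.Poly_Mapping"
    "HOL-Computational_Algebra.Polynomial"
    "HOL-Algebra.QuotRing"
    "HOL-Algebra.Chinese_Remainder"
    "HOL-Algebra.Module"
    "Jordan_Normal_Form.Matrix"
begin

text \<open>
  A \<open>K\<close>-algebra over the whole of a field type \<open>'k\<close> is represented by a record of type
  \<open>('k, 'a) module\<close>, whose fields include both the ring operations and the scalar
  multiplication. (The locale \<open>algebra\<close> of HOL-Algebra covers commutative algebras only.)
\<close>

subsection \<open>Free algebras\<close>

text \<open>
  Finitely supported functions on a monoid carry the convolution product, but the monoid has
  to be an instance of \<open>monoid_add\<close>. The free monoid is therefore written additively, as a
  copy of the type of lists.
\<close>

datatype 'a fword = FWord (letters: "'a list")

instantiation fword :: (type) monoid_add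
begin

definition zero_fword :: "'a fword" where
  "0 = FWord []"

definition plus_fword :: "'a fword \<Rightarrow> 'a fword \<Rightarrow> 'a fword" where
  "u + v = FWord (letters u @ letters v)"

instance
  by standard (auto simp: zero_fword_def plus_fword_def)

end

definition free_algebra :: "('k :: field, 'g fword \<Rightarrow>\<^sub>0 'k) module" where
  "free_algebra =
     \<lparr>carrier = UNIV, mult = (*), one = 1, zero = 0, add = (+),
      smult = (\<lambda>c p. Poly_Mapping.map ((*) c) p)\<rparr>"

definition gen :: "'g \<Rightarrow> ('g fword \<Rightarrow>\<^sub>0 'k :: field)" where
  "gen g = Poly_Mapping.single (FWord [g]) 1"

definition scalar :: "'k :: field \<Rightarrow> ('g fword \<Rightarrow>\<^sub>0 'k)" where
  "scalar c = Poly_Mapping.single 0 c"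


subsection \<open>Quotients, products and isomorphisms of algebras\<close>

definition quot_algebra :: "('k, 'a) module \<Rightarrow> 'a set \<Rightarrow> ('k, 'a set) module" where
  "quot_algebra A I =
     ring.extend (A Quot I) (module.fields (\<lambda>c X. \<Union>x\<in>X. I +>\<^bsub>A\<^esub> (c \<odot>\<^bsub>A\<^esub> x)))"

definition prod_algebra :: "('k, 'a) module \<Rightarrow> ('k, 'b) module \<Rightarrow> ('k, 'a \<times> 'b) module" where
  "prod_algebra A B =
     ring.extend (RDirProd A B) (module.fields (\<lambda>c (x, y). (c \<odot>\<^bsub>A\<^esub> x, c \<odot>\<^bsub>B\<^esub> y)))"

definition algebra_iso :: "('k, 'a) module \<Rightarrow> ('k, 'b) module \<Rightarrow> ('a \<Rightarrow> 'b) set" where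
  "algebra_iso A B =
     {h \<in> ring_iso A B. \<forall>c. \<forall>x\<in>carrier A. h (c \<odot>\<^bsub>A\<^esub> x) = c \<odot>\<^bsub>B\<^esub> h x}"

definition isomorphic_algebras :: "('k, 'a) module \<Rightarrow> ('k, 'b) module \<Rightarrow> bool" where
  "isomorphic_algebras A B \<longleftrightarrow> algebra_iso A B \<noteq> {}"


subsection \<open>Semisimplicity\<close>

text \<open>
  Left ideals are the submodules of the left regular module; in a unital algebra they are
  automatically linear subspaces, so the scalar multiplication plays no role here.
\<close>

definition left_ideal :: "'a set \<Rightarrow> ('a, 'm) ring_scheme \<Rightarrow> bool" where
  "left_ideal L R \<longleftrightarrow>
     additive_subgroup L R \<and> (\<forall>r\<in>carrier R. \<forall>x\<in>L. r \<otimes>\<^bsub>R\<^esub> x \<in> L)"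

definition simple_left_ideal :: "'a set \<Rightarrow> ('a, 'm) ring_scheme \<Rightarrow> bool" where
  "simple_left_ideal L R \<longleftrightarrow>
     left_ideal L R \<and> L \<noteq> {\<zero>\<^bsub>R\<^esub>} \<and>
     (\<forall>M. left_ideal M R \<and> M \<subseteq> L \<longrightarrow> M = {\<zero>\<^bsub>R\<^esub>} \<or> M = L)"

text \<open>
  The left regular module is the internal direct sum of the (possibly infinite) family
  \<open>\<L>\<close> of left ideals: their sum is everything, and they are independent.
\<close>

definition left_direct_sum :: "('a, 'm) ring_scheme \<Rightarrow> 'a set set \<Rightarrow> bool" where
  "left_direct_sum R \<L> \<longleftrightarrow>
     (\<forall>L\<in>\<L>. left_ideal L R) \<and>
     (\<forall>x\<in>carrier R. \<exists>F f. finite F \<and> F \<subseteq> \<L> \<and> f \<in> (\<Pi> L\<in>F. L) \<and> x = finsum R f F) \<and>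
     (\<forall>F f. finite F \<and> F \<subseteq> \<L> \<and> f \<in> (\<Pi> L\<in>F. L) \<and> finsum R f F = \<zero>\<^bsub>R\<^esub>
        \<longrightarrow> (\<forall>L\<in>F. f L = \<zero>\<^bsub>R\<^esub>))"

definition semisimple :: "('a, 'm) ring_scheme \<Rightarrow> bool" where
  "semisimple R \<longleftrightarrow>
     ring R \<and> (\<exists>\<L>. (\<forall>L\<in>\<L>. simple_left_ideal L R) \<and> left_direct_sum R \<L>)"


subsection \<open>The algebras \<open>\<D>\<^sub>3(\<alpha>\<^sub>1, \<alpha>\<^sub>2)\<close>\<close>

datatype generator = Gen_a | Gen_b | Gen_c

definition D3_relators :: "'k :: field \<Rightarrow> 'k \<Rightarrow> (generator fword \<Rightarrow>\<^sub>0 'k) set" where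
  "D3_relators \<alpha>\<^sub>1 \<alpha>\<^sub>2 =
     (let a = gen Gen_a; b = gen Gen_b; c = gen Gen_c in
      {a * a - scalar \<alpha>\<^sub>1, b * b - scalar \<alpha>\<^sub>1, c * c - scalar \<alpha>\<^sub>1,
       c * a + b * c + a * b - scalar \<alpha>\<^sub>2,
       c * b + b * a + a * c - scalar \<alpha>\<^sub>2})"

text \<open>\<open>Idl\<close> is the generated two-sided ideal.\<close>

definition D3 :: "'k :: field \<Rightarrow> 'k \<Rightarrow> ('k, (generator fword \<Rightarrow>\<^sub>0 'k) set) module" where
  "D3 \<alpha>\<^sub>1 \<alpha>\<^sub>2 = quot_algebra free_algebra (Idl\<^bsub>free_algebra\<^esub> (D3_relators \<alpha>\<^sub>1 \<alpha>\<^sub>2))"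

definition mat2_cubed :: "('k :: field, 'k mat \<times> 'k mat \<times> 'k mat) module" where
  "mat2_cubed =
     (let M = module_mat TYPE('k) 2 2 in prod_algebra M (prod_algebra M M))"

end

theory Submission
  imports Defs
begin

text \<open>
  Sending two of the generators to a matrix \<open>A\<close> and the third to a matrix \<open>C\<close> is a representation
  of \<open>\<D>\<^sub>3(\<alpha>\<^sub>1, \<alpha>\<^sub>2)\<close> as soon as \<open>A\<^sup>2 = C\<^sup>2 = \<alpha>\<^sub>1\<close> and \<open>AC + CA = \<alpha>\<^sub>2 - \<alpha>\<^sub>1\<close>; these are the
  relations of a Clifford algebra whose discriminant is, up to sign,
  \<open>(3\<alpha>\<^sub>1 - \<alpha>\<^sub>2)(\<alpha>\<^sub>1 + \<alpha>\<^sub>2)\<close>, and it is all of \<open>\<K>\<^bsup>2\<times>2\<^esup>\<close> when this is non-zero.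
  The element \<open>z = ab + ba - \<alpha>\<^sub>2 + \<alpha>\<^sub>1\<close> and its two cyclic shifts are central in
  \<open>\<D>\<^sub>3(\<alpha>\<^sub>1, \<alpha>\<^sub>2)\<close>, their sum is \<open>3\<alpha>\<^sub>1 - \<alpha>\<^sub>2\<close>, and \<open>(a - b)z = 0\<close>. Up to the factor
  \<open>3\<alpha>\<^sub>1 - \<alpha>\<^sub>2\<close> they are the central idempotents that split \<open>\<D>\<^sub>3(\<alpha>\<^sub>1, \<alpha>\<^sub>2)\<close> into three such Clifford
  algebras.
  If the discriminant vanishes, there is a representation by upper triangular matrices whose image
  contains a non-zero strictly upper triangular one; a quotient then has a non-zero ideal of square
  zero, which is impossible for a semisimple algebra.
\<close>

section \<open>Semisimple rings\<close>

text \<open>\<open>ring\<close> sees only the five ring fields, so the ring axioms pass from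
  \<open>free_algebra Quot J\<close> to \<open>quot_algebra\<close>, whose record has the extra
  field \<open>smult\<close>.\<close>

lemma ring_cong:
  fixes R :: "('a, 'm) ring_scheme" and S :: "('a, 'n) ring_scheme"
  assumes "carrier R = carrier S" "mult R = mult S" "one R = one S" "zero R = zero S" "add R = add S"
  shows "ring R \<longleftrightarrow> ring S"
proof -
  have Units: "Units (add_monoid R) = Units (add_monoid S)"
    by (simp add: Units_def assms)
  show ?thesis
    unfolding ring_def abelian_group_def abelian_monoid_def abelian_group_axioms_def
      ring_axioms_def comm_monoid_def comm_monoid_axioms_def comm_group_def
      group_def group_axioms_def monoid_def Units by (simp add: assms)
qed

lemma left_ideal_Int_ideal:
  assumes "left_ideal L R" "ideal N R"
  shows "left_ideal (L \<inter> N) R"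
proof -
  interpret N: ideal N R by fact
  interpret L: additive_subgroup L R using assms(1) by (simp add: left_ideal_def)
  have "additive_subgroup (L \<inter> N) R"
    using N.add.subgroups_Inter_pair[OF L.a_subgroup N.a_subgroup] by (rule additive_subgroupI)
  then show ?thesis
    using assms(1) by (auto simp: left_ideal_def N.I_l_closed L.a_Hcarr)
qed

text \<open>A simple left ideal \<open>L\<close> either meets \<open>N\<close> trivially, and then
  \<open>x\<close> in \<open>N\<close> annihilates it because \<open>x \<otimes> l\<close> lies in
  \<open>L \<inter> N\<close>, or it is contained in \<open>N\<close>, and then
  \<open>x \<otimes> l\<close> lies in \<open>I\<close>. Decomposing the unit along simple left
  ideals gives \<open>x \<in> I\<close>. Working relative to \<open>I\<close> avoids passing to a
  further quotient ring.\<close>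

lemma semisimple_square_zero_ideal:
  assumes "semisimple R" "ideal I R" "ideal N R"
    and square: "\<And>x y. x \<in> N \<Longrightarrow> y \<in> N \<Longrightarrow> x \<otimes>\<^bsub>R\<^esub> y \<in> I"
  shows "N \<subseteq> I"
proof
  fix x assume x: "x \<in> N"
  interpret ring R using assms(1) by (simp add: semisimple_def)
  interpret I: ideal I R by fact
  interpret N: ideal N R by fact
  obtain \<L> where simple: "\<And>L. L \<in> \<L> \<Longrightarrow> simple_left_ideal L R" and sum: "left_direct_sum R \<L>"
    using assms(1) by (auto simp: semisimple_def)
  have *: "x \<otimes>\<^bsub>R\<^esub> l \<in> I" if "L \<in> \<L>" "l \<in> L" for L l
  proof -
    have L: "left_ideal L R" using simple[OF that(1)] by (simp add: simple_left_ideal_def)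
    then interpret L: additive_subgroup L R by (simp add: left_ideal_def)
    have xl: "x \<otimes>\<^bsub>R\<^esub> l \<in> L \<inter> N"
      using L x that(2) N.I_r_closed L.a_Hcarr by (simp add: left_ideal_def N.a_Hcarr)
    have "L \<inter> N = {\<zero>\<^bsub>R\<^esub>} \<or> L \<inter> N = L"
      using simple[OF that(1)] left_ideal_Int_ideal[OF L assms(3)]
      by (simp add: simple_left_ideal_def)
    then show ?thesis
    proof
      assume "L \<inter> N = {\<zero>\<^bsub>R\<^esub>}"
      then have "x \<otimes>\<^bsub>R\<^esub> l = \<zero>\<^bsub>R\<^esub>" using xl by blast
      then show ?thesis by simp
    next
      assume "L \<inter> N = L"
      then have "l \<in> N" using that(2) by blast
      then show ?thesis using square x by blast
    qed
  qed
  obtain F f where F: "finite F" "F \<subseteq> \<L>" "f \<in> (\<Pi> L\<in>F. L)" and one: "\<one>\<^bsub>R\<^esub> = finsum R f F"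
  proof -
    have "\<exists>F f. finite F \<and> F \<subseteq> \<L> \<and> f \<in> (\<Pi> L\<in>F. L) \<and> \<one>\<^bsub>R\<^esub> = finsum R f F"
      using sum one_closed by (simp only: left_direct_sum_def)
    then show thesis using that by blast
  qed
  have sub: "L \<subseteq> carrier R" if "L \<in> F" for L
    using simple[of L] that F(2) additive_subgroup.a_subset[of L R]
    by (auto simp: simple_left_ideal_def left_ideal_def)
  have f: "f \<in> F \<rightarrow> carrier R"
    using F(3) sub by blast
  have "x = x \<otimes>\<^bsub>R\<^esub> finsum R f F"
    using one x N.a_Hcarr by (metis r_one)
  also have "\<dots> = finsum R (\<lambda>L. x \<otimes>\<^bsub>R\<^esub> f L) F"
    using F(1) f x by (simp add: finsum_rdistr N.a_Hcarr)
  also have "\<dots> \<in> I"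
  proof -
    have "finsum R g G \<in> I" if "finite G" "g \<in> G \<rightarrow> I" for g :: "'a set \<Rightarrow> 'a" and G
      using that
    proof (induction G)
      case (insert L G)
      then have "g \<in> G \<rightarrow> carrier R" "g L \<in> carrier R"
        using I.a_subset by auto
      then show ?case using insert by auto
    qed simp
    moreover have "(\<lambda>L. x \<otimes>\<^bsub>R\<^esub> f L) \<in> F \<rightarrow> I" using F(2,3) * by blast
    ultimately show ?thesis using F(1) by blast
  qed
  finally show "x \<in> I" .
qed

section \<open>Semisimplicity from orthogonal idempotents\<close>

context ring
begin

lemma left_ideal_rprincipal:
  assumes "e \<in> carrier R"
  shows "left_ideal ((\<lambda>x. x \<otimes> e) ` carrier R) R"
  unfolding left_ideal_def
proof (intro conjI ballI additive_subgroupI add.subgroupI)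
  show "a \<oplus> b \<in> (\<lambda>x. x \<otimes> e) ` carrier R"
    if "a \<in> (\<lambda>x. x \<otimes> e) ` carrier R" "b \<in> (\<lambda>x. x \<otimes> e) ` carrier R" for a b
    using that assms by (auto simp: image_iff l_distr[symmetric])
  show "\<ominus> a \<in> (\<lambda>x. x \<otimes> e) ` carrier R"
    if "a \<in> (\<lambda>x. x \<otimes> e) ` carrier R" for a
    using that assms by (auto simp: image_iff l_minus[symmetric])
  show "r \<otimes> a \<in> (\<lambda>x. x \<otimes> e) ` carrier R"
    if "r \<in> carrier R" "a \<in> (\<lambda>x. x \<otimes> e) ` carrier R" for r a
    using that assms by (auto simp: image_iff m_assoc[symmetric])
qed (use assms in auto)

text \<open>A non-zero left ideal inside \<open>R e\<close> contains some
  \<open>x \<otimes> e \<noteq> \<zero>\<close>, which can be multiplied back to \<open>e\<close>;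
  hence it contains all of \<open>R e\<close>.\<close>

lemma simple_left_ideal_rprincipal:
  assumes e: "e \<in> carrier R" "e \<noteq> \<zero>"
    and simple: "\<And>x. x \<in> carrier R \<Longrightarrow> x \<otimes> e \<noteq> \<zero> \<Longrightarrow> \<exists>y\<in>carrier R. y \<otimes> (x \<otimes> e) = e"
  shows "simple_left_ideal ((\<lambda>x. x \<otimes> e) ` carrier R) R"
  unfolding simple_left_ideal_def
proof (intro conjI allI impI)
  show "left_ideal ((\<lambda>x. x \<otimes> e) ` carrier R) R"
    by (rule left_ideal_rprincipal) fact
  have "e \<in> (\<lambda>x. x \<otimes> e) ` carrier R"
    using e by (auto intro: image_eqI[of _ _ \<one>])
  then show "(\<lambda>x. x \<otimes> e) ` carrier R \<noteq> {\<zero>}"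
    using e by blast
next
  fix M assume M: "left_ideal M R \<and> M \<subseteq> (\<lambda>x. x \<otimes> e) ` carrier R"
  then interpret M: additive_subgroup M R by (simp add: left_ideal_def)
  have M_mult: "r \<otimes> m \<in> M" if "r \<in> carrier R" "m \<in> M" for r m
    using M that by (simp add: left_ideal_def)
  show "M = {\<zero>} \<or> M = (\<lambda>x. x \<otimes> e) ` carrier R"
  proof (cases "M = {\<zero>}")
    case False
    then obtain m where m: "m \<in> M" "m \<noteq> \<zero>" using M.zero_closed by blast
    then obtain x where x: "x \<in> carrier R" "m = x \<otimes> e" using M by blast
    then obtain y where "y \<in> carrier R" "y \<otimes> m = e" using simple m by blast
    then have "e \<in> M" using M_mult m by blast
    then have "(\<lambda>x. x \<otimes> e) ` carrier R \<subseteq> M" using M_mult by blast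
    then show ?thesis using M by blast
  qed simp
qed

text \<open>The left regular module is the direct sum of the simple left ideals generated by the \<open>e i\<close>.\<close>

lemma semisimple_if_orthogonal_idempotents:
  assumes A: "finite A" and e: "\<And>i. i \<in> A \<Longrightarrow> e i \<in> carrier R" "\<And>i. i \<in> A \<Longrightarrow> e i \<noteq> \<zero>"
    and orth: "\<And>i j. i \<in> A \<Longrightarrow> j \<in> A \<Longrightarrow> e i \<otimes> e j = (if i = j then e i else \<zero>)"
    and one: "finsum R e A = \<one>"
    and simple: "\<And>i x. i \<in> A \<Longrightarrow> x \<in> carrier R \<Longrightarrow> x \<otimes> e i \<noteq> \<zero> \<Longrightarrow>
      \<exists>y\<in>carrier R. y \<otimes> (x \<otimes> e i) = e i"
  shows "semisimple R"
proof -
  define L where "L i = (\<lambda>x. x \<otimes> e i) ` carrier R" for i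
  \<comment> \<open>Right multiplication by \<open>e j\<close> is the projection onto the summand
    \<open>L j\<close>.\<close>
  have L_id: "x \<otimes> e j = (if i = j then x else \<zero>)" if "i \<in> A" "j \<in> A" "x \<in> L i" for i j x
  proof -
    obtain y where "y \<in> carrier R" "x = y \<otimes> e i" using \<open>x \<in> L i\<close> by (auto simp: L_def)
    then show ?thesis using e that orth[of i j] by (auto simp: m_assoc)
  qed
  have e_L: "e i \<in> L i" if "i \<in> A" for i
    unfolding L_def using e that by (auto intro: image_eqI[of _ _ \<one>])
  have L_carrier: "L i \<subseteq> carrier R" if "i \<in> A" for i
    using e that by (auto simp: L_def)
  \<comment> \<open>The summands of \<open>left_direct_sum\<close> form a set rather than an indexed
    family, so different indices must give different left ideals.\<close>
  have inj: "inj_on L A"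
  proof (rule inj_onI)
    fix i j assume ij: "i \<in> A" "j \<in> A" "L i = L j"
    then have "e i \<otimes> e i = (if j = i then e i else \<zero>)" using L_id[of j i "e i"] e_L by metis
    then show "i = j" using e ij orth[of i i] by (auto split: if_splits)
  qed
  have simple_L: "simple_left_ideal (L i) R" if "i \<in> A" for i
    unfolding L_def using that e simple by (intro simple_left_ideal_rprincipal) auto
  have "left_direct_sum R (L ` A)"
    unfolding left_direct_sum_def
  proof (intro conjI ballI allI impI)
    show "left_ideal M R" if "M \<in> L ` A" for M
      using that simple_L by (auto simp: simple_left_ideal_def)
  next
    fix x assume x: "x \<in> carrier R"
    define f where "f M = x \<otimes> e (the_inv_into A L M)" for M
    have f_L: "f (L i) = x \<otimes> e i" if "i \<in> A" for i
      using that inj by (simp add: f_def the_inv_into_f_f)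
    have f_in: "f \<in> (\<Pi> M\<in>L ` A. M)"
      using x f_L by (auto simp: L_def)
    have "x = x \<otimes> finsum R e A" using x one by simp
    also have "\<dots> = finsum R (\<lambda>i. x \<otimes> e i) A"
      using A e x by (intro finsum_rdistr) auto
    also have "\<dots> = finsum R (\<lambda>i. f (L i)) A"
      using f_L e x by (intro finsum_cong') auto
    also have "\<dots> = finsum R f (L ` A)"
      using inj e x f_L by (intro finsum_reindex[symmetric]) auto
    finally show "\<exists>F f. finite F \<and> F \<subseteq> L ` A \<and> f \<in> (\<Pi> L\<in>F. L) \<and> x = finsum R f F"
      using A f_in by blast
  next
    fix F f M
    assume F: "finite F \<and> F \<subseteq> L ` A \<and> f \<in> (\<Pi> L\<in>F. L) \<and> finsum R f F = \<zero>" and M: "M \<in> F"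
    obtain i where i: "i \<in> A" "M = L i" using F M by blast
    have f: "f \<in> F \<rightarrow> carrier R" using F L_carrier by blast
    have f_e: "f N \<otimes> e i = (if N = M then f N else \<zero>)" if N: "N \<in> F" for N
    proof -
      obtain j where "j \<in> A" "N = L j" using F N by blast
      moreover have "f N \<in> N" using F N by blast
      ultimately show ?thesis using L_id[of j i "f N"] i inj by (auto simp: inj_on_eq_iff)
    qed
    \<comment> \<open>Projecting the relation to the summand \<open>M = L i\<close> isolates
      \<open>f M\<close>.\<close>
    have "\<zero> = finsum R f F \<otimes> e i" using F e i by simp
    also have "\<dots> = finsum R (\<lambda>N. f N \<otimes> e i) F"
      using F f e i by (intro finsum_ldistr) auto
    also have "\<dots> = finsum R (\<lambda>N. if M = N then f N else \<zero>) F"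
      using f f_e by (intro finsum_cong') auto
    also have "\<dots> = f M"
      using F f M by (intro finsum_singleton) auto
    finally show "f M = \<zero>" by simp
  qed
  then show ?thesis
    unfolding semisimple_def using simple_L ring_axioms by (auto intro!: exI[of _ "L ` A"])
qed

end

section \<open>Matrix representations of free algebras\<close>

text \<open>Matrices of fixed size form a whole type, hence an instance of \<open>ring_1\<close> in
  which one computes without carrier sets. The passage to \<open>'k mat\<close> is made at the end
  by \<open>m2_mat\<close>.\<close>

datatype 'k m2 = M2 (m11: 'k) (m12: 'k) (m21: 'k) (m22: 'k)

instantiation m2 :: (ring_1) ring_1
begin

definition "0 = M2 0 0 0 0"
definition "1 = M2 1 0 0 1"
definition "A + B = M2 (m11 A + m11 B) (m12 A + m12 B) (m21 A + m21 B) (m22 A + m22 B)"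
definition "- A = M2 (- m11 A) (- m12 A) (- m21 A) (- m22 A)"
definition "A - B = M2 (m11 A - m11 B) (m12 A - m12 B) (m21 A - m21 B) (m22 A - m22 B)"
definition "A * B =
  M2 (m11 A * m11 B + m12 A * m21 B) (m11 A * m12 B + m12 A * m22 B)
     (m21 A * m11 B + m22 A * m21 B) (m21 A * m12 B + m22 A * m22 B)"

instance
  by standard
    (auto simp: zero_m2_def one_m2_def plus_m2_def uminus_m2_def minus_m2_def times_m2_def
      algebra_simps)

end

lemmas m2_defs = zero_m2_def one_m2_def plus_m2_def uminus_m2_def minus_m2_def times_m2_def

definition m2_scalar :: "'k::ring_1 \<Rightarrow> 'k m2" where
  "m2_scalar c = M2 c 0 0 c"

section \<open>The free algebra: ring structure, central scalars, induction\<close>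

lemma free_algebra_simps [simp]:
  "carrier free_algebra = UNIV" "mult free_algebra = (*)" "one free_algebra = 1"
  "zero free_algebra = 0" "add free_algebra = (+)"
  by (simp_all add: free_algebra_def)

lemma smult_free_algebra [simp]: "c \<odot>\<^bsub>free_algebra\<^esub> p = scalar c * p"
  by (simp add: free_algebra_def scalar_def mult_map_scale_conv_mult)

lemma ring_free_algebra: "ring (free_algebra :: ('k::field, 'g fword \<Rightarrow>\<^sub>0 'k) module)"
proof (rule ringI)
  show "abelian_group (free_algebra :: ('k, 'g fword \<Rightarrow>\<^sub>0 'k) module)"
    by (rule abelian_groupI) (auto simp: add.assoc add.commute intro: exI[of _ "- x" for x])
  show "Group.monoid (free_algebra :: ('k, 'g fword \<Rightarrow>\<^sub>0 'k) module)"
    by (rule monoidI) (auto simp: mult.assoc)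
qed (auto simp: algebra_simps)

lemma a_minus_free_algebra [simp]: "p \<ominus>\<^bsub>free_algebra\<^esub> q = p - q"
proof -
  interpret ring "free_algebra :: ('k::field, 'g fword \<Rightarrow>\<^sub>0 'k) module"
    by (rule ring_free_algebra)
  have "\<ominus>\<^bsub>free_algebra\<^esub> q = - q"
    by (rule minus_equality) auto
  then show ?thesis by (simp add: a_minus_def)
qed

lemma scalar_add: "scalar (c + d) = scalar c + scalar d"
  by (simp add: scalar_def single_add)

lemma scalar_uminus: "scalar (- c) = - scalar c"
  by (simp add: scalar_def single_uminus)

lemma scalar_diff: "scalar (c - d) = scalar c - scalar d"
  by (simp add: scalar_def single_diff)

lemma scalar_mult: "scalar (c * d) = scalar c * scalar d"
  by (simp add: scalar_def mult_single)

lemma scalar_mult_left: "scalar c * (scalar d * p) = scalar (c * d) * p"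
  by (simp add: scalar_mult mult.assoc)

lemma scalar_0 [simp]: "scalar 0 = 0" and scalar_1 [simp]: "scalar 1 = 1"
  by (simp_all add: scalar_def)

text \<open>Updating a finitely supported function outside its support amounts to adding a
  monomial.\<close>

lemma poly_mapping_add_induct [case_names single add]:
  assumes "\<And>w c. P (Poly_Mapping.single w c)" "\<And>p q. P p \<Longrightarrow> P q \<Longrightarrow> P (p + q)"
  shows "P (p :: 'a \<Rightarrow>\<^sub>0 'b::monoid_add)"
proof (induction p rule: update_induct)
  case const
  show ?case using assms(1)[of _ 0] by simp
next
  case (update f a b)
  then have "Poly_Mapping.update a b f = f + Poly_Mapping.single a b"
    by (intro poly_mapping_eqI) (auto simp: lookup_update lookup_add lookup_single in_keys_iff when_def)
  then show ?case using assms update by metis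
qed

lemma scalar_commute: "scalar c * p = p * scalar c"
  by (induction p rule: poly_mapping_add_induct)
    (simp_all add: scalar_def mult_single mult.commute algebra_simps)

lemma single_FWord_Cons:
  "Poly_Mapping.single (FWord (g # ws)) c = gen g * Poly_Mapping.single (FWord ws) c"
  by (simp add: gen_def mult_single plus_fword_def)

text \<open>A monomial arises from its coefficient by multiplying with its letters from the left,
  one at a time.\<close>

lemma free_algebra_induct [case_names scalar add gen]:
  assumes scalar: "\<And>c. P (scalar c)" and add: "\<And>p q. P p \<Longrightarrow> P q \<Longrightarrow> P (p + q)"
    and gen: "\<And>g p. P p \<Longrightarrow> P (gen g * p)"
  shows "P (p :: 'g fword \<Rightarrow>\<^sub>0 'k::field)"
proof (induction p rule: poly_mapping_add_induct)
  case (single w c)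
  have "P (Poly_Mapping.single (FWord ws) c)" for ws
  proof (induction ws)
    case Nil
    then show ?case using scalar[of c] by (simp add: scalar_def zero_fword_def)
  next
    case (Cons g ws)
    then show ?case using gen by (simp add: single_FWord_Cons)
  qed
  then show ?case by (cases w) simp
qed (rule add)

text \<open>The homomorphism that the universal property of the free algebra attaches to
  \<open>f\<close>.\<close>

definition m2_eval :: "('g \<Rightarrow> 'k m2) \<Rightarrow> ('g fword \<Rightarrow>\<^sub>0 'k::field) \<Rightarrow> 'k m2" where
  "m2_eval f p =
     (\<Sum>w\<in>Poly_Mapping.keys p. m2_scalar (Poly_Mapping.lookup p w) * prod_list (map f (letters w)))"

lemma m2_eval_add [simp]: "m2_eval f (p + q) = m2_eval f p + m2_eval f q"
  unfolding m2_eval_def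
  by (rule setsum_keys_plus_distrib) (simp_all add: m2_scalar_def m2_defs algebra_simps)

lemma m2_eval_single:
  "m2_eval f (Poly_Mapping.single w c) = m2_scalar c * prod_list (map f (letters w))"
  by (cases "c = 0") (simp_all add: m2_eval_def m2_scalar_def m2_defs)

lemma m2_eval_scalar [simp]: "m2_eval f (scalar c) = m2_scalar c"
  by (simp add: scalar_def m2_eval_single zero_fword_def)

lemma m2_eval_gen [simp]: "m2_eval f (gen g) = f g"
  by (simp add: gen_def m2_eval_single m2_scalar_def m2_defs)

lemma m2_eval_0 [simp]: "m2_eval f 0 = 0" and m2_eval_1 [simp]: "m2_eval f 1 = 1"
  using m2_eval_scalar[of f 0] m2_eval_scalar[of f 1] by (simp_all add: m2_scalar_def m2_defs)

lemma m2_eval_uminus [simp]: "m2_eval f (- p) = - m2_eval f p"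
  using m2_eval_add[of f p "- p"] by (simp add: eq_neg_iff_add_eq_0 add.commute)

lemma m2_eval_diff [simp]: "m2_eval f (p - q) = m2_eval f p - m2_eval f q"
  using m2_eval_add[of f p "- q"] by simp

lemma m2_eval_sum [simp]: "m2_eval f (sum p A) = (\<Sum>i\<in>A. m2_eval f (p i))"
  by (induction A rule: infinite_finite_induct) simp_all

text \<open>By additivity in both arguments only monomials matter; there the coefficient of the
  second factor has to move past the matrices of the first, and scalar matrices are central.\<close>

lemma m2_eval_mult [simp]:
  fixes f :: "'g \<Rightarrow> 'k::field m2"
  shows "m2_eval f (p * q) = m2_eval f p * m2_eval f q"
proof (induction p rule: poly_mapping_add_induct)
  case (single v c)
  show ?case
  proof (induction q rule: poly_mapping_add_induct)
    case (single w d)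
    have central: "A * (m2_scalar d * B) = m2_scalar d * (A * B)" for A B :: "'k m2"
      by (simp add: m2_scalar_def m2_defs algebra_simps)
    have "m2_scalar (c * d) = m2_scalar c * m2_scalar d"
      by (simp add: m2_scalar_def m2_defs)
    then show ?case
      by (simp add: mult_single m2_eval_single plus_fword_def central mult.assoc)
  qed (simp add: algebra_simps)
qed (simp add: algebra_simps)

section \<open>The relations of \<open>\<D>\<^sub>3\<close>\<close>

text \<open>The relations are invariant under cyclic shifts of \<open>a, b, c\<close>; the generators are parameters so that every result can be shifted.\<close>

locale D3_relations =
  fixes J :: "(generator fword \<Rightarrow>\<^sub>0 'k::field) set" and \<alpha>\<^sub>1 \<alpha>\<^sub>2 :: 'k and a b c :: "generator fword \<Rightarrow>\<^sub>0 'k"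
  assumes J_add: "p \<in> J \<Longrightarrow> q \<in> J \<Longrightarrow> p + q \<in> J"
    and J_uminus: "p \<in> J \<Longrightarrow> - p \<in> J"
    and J_lmult: "p \<in> J \<Longrightarrow> r * p \<in> J"
    and J_rmult: "p \<in> J \<Longrightarrow> p * r \<in> J"
    and squares: "a * a - scalar \<alpha>\<^sub>1 \<in> J" "b * b - scalar \<alpha>\<^sub>1 \<in> J" "c * c - scalar \<alpha>\<^sub>1 \<in> J"
    and triples: "c * a + b * c + a * b - scalar \<alpha>\<^sub>2 \<in> J" "c * b + b * a + a * c - scalar \<alpha>\<^sub>2 \<in> J"
    and generators: "range gen = {a, b, c}"
begin

lemma J_diff: "p \<in> J \<Longrightarrow> q \<in> J \<Longrightarrow> p - q \<in> J"
  using J_add[of p "- q"] J_uminus[of q] by simp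

lemmas J_closed = J_add J_uminus J_diff J_lmult J_rmult squares triples

lemma J_0: "0 \<in> J"
  using J_lmult[OF squares(1), of 0] by simp

lemma rotate: "D3_relations J \<alpha>\<^sub>1 \<alpha>\<^sub>2 b c a"
proof
  show "a * b + c * a + b * c - scalar \<alpha>\<^sub>2 \<in> J" "a * c + c * b + b * a - scalar \<alpha>\<^sub>2 \<in> J"
    using triples by (simp_all add: add.commute add.left_commute)
  show "range gen = {b, c, a}" by (simp add: generators insert_commute)
qed (fact J_add J_uminus J_lmult J_rmult squares)+

lemma induct [case_names scalar add mult]:
  assumes "\<And>d. P (scalar d)" "\<And>p q. P p \<Longrightarrow> P q \<Longrightarrow> P (p + q)"
    and "\<And>h p. h \<in> {a, b, c} \<Longrightarrow> P p \<Longrightarrow> P (h * p)"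
  shows "P p"
proof (induction p rule: free_algebra_induct)
  case (gen g p)
  have "gen g \<in> {a, b, c}" unfolding generators[symmetric] by (rule rangeI)
  then show ?case using assms(3) gen by blast
qed (rule assms; assumption?)+

definition z :: "generator fword \<Rightarrow>\<^sub>0 'k" where
  "z = a * b + b * a - scalar \<alpha>\<^sub>2 + scalar \<alpha>\<^sub>1"

text \<open>With a generator as left factor, centrality of scalars becomes an oriented rewrite rule
  that collects all scalars in front.\<close>

lemma scalar_right:
  "h * scalar d = scalar d * h"
  "h * (scalar d * p) = scalar d * (h * p)" if "h \<in> {a, b, c}"
  by (metis scalar_commute, metis mult.assoc scalar_commute)

lemmas scalar_simps = scalar_right[of a, simplified] scalar_right[of b, simplified]
  scalar_right[of c, simplified] scalar_mult[symmetric] scalar_mult_left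

text \<open>Put \<open>t = c * a + b * c + a * b\<close>. In \<open>t * a - b * t\<close> the words
  \<open>b * c * a\<close> cancel; what remains is, modulo the squares,
  \<open>a * b * a - b * a * b\<close>. As \<open>t\<close> is the scalar
  \<open>\<alpha>\<^sub>2\<close> modulo \<open>J\<close>, this equals
  \<open>\<alpha>\<^sub>2\<close> times \<open>a - b\<close>, which is the claim after expanding
  \<open>z\<close>.\<close>

lemma diff_mult_z: "(a - b) * z \<in> J"
proof -
  have "(a - b) * z = (a * a - scalar \<alpha>\<^sub>1) * b - (b * b - scalar \<alpha>\<^sub>1) * a
      + (c * a + b * c + a * b - scalar \<alpha>\<^sub>2) * a - b * (c * a + b * c + a * b - scalar \<alpha>\<^sub>2)
      - c * (a * a - scalar \<alpha>\<^sub>1) + (b * b - scalar \<alpha>\<^sub>1) * c"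
    by (simp add: z_def algebra_simps scalar_simps)
  also have "\<dots> \<in> J" by (intro J_closed)
  finally show ?thesis .
qed

text \<open>Since \<open>a * a\<close> is scalar modulo \<open>J\<close>, it commutes with
  \<open>b\<close>, and so \<open>a\<close> commutes with \<open>a * b + b * a\<close>.\<close>

lemma z_commute_a: "a * z - z * a \<in> J"
proof -
  have "a * z - z * a = (a * a - scalar \<alpha>\<^sub>1) * b - b * (a * a - scalar \<alpha>\<^sub>1)"
    by (simp add: z_def algebra_simps scalar_simps)
  also have "\<dots> \<in> J" by (intro J_closed)
  finally show ?thesis .
qed

lemma z_commute_b: "b * z - z * b \<in> J"
proof -
  have "b * z - z * b = (b * b - scalar \<alpha>\<^sub>1) * a - a * (b * b - scalar \<alpha>\<^sub>1)"
    by (simp add: z_def algebra_simps scalar_simps)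
  also have "\<dots> \<in> J" by (intro J_closed)
  finally show ?thesis .
qed

lemma z_commute_c: "c * z - z * c \<in> J"
proof -
  \<comment> \<open>Modulo \<open>J\<close>, \<open>u = 0\<close> makes the three anticommutators of
    the generators add up to a scalar. As \<open>c\<close> commutes with the two that involve
    \<open>c\<close>, it commutes with the third, and hence with \<open>z\<close>.\<close>
  define u where "u = (c * a + b * c + a * b - scalar \<alpha>\<^sub>2) + (c * b + b * a + a * c - scalar \<alpha>\<^sub>2)"
  have u: "u \<in> J" unfolding u_def by (intro J_closed)
  have "c * z - z * c = c * u - u * c
      - ((c * c - scalar \<alpha>\<^sub>1) * a - a * (c * c - scalar \<alpha>\<^sub>1))
      - ((c * c - scalar \<alpha>\<^sub>1) * b - b * (c * c - scalar \<alpha>\<^sub>1))"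
    by (simp add: u_def z_def algebra_simps scalar_simps)
  also have "\<dots> \<in> J" by (intro J_closed u)
  finally show ?thesis .
qed

text \<open>The commutator with \<open>z\<close> is a derivation, so it suffices that it vanishes
  modulo \<open>J\<close> on the generators.\<close>

lemma z_commute: "p * z - z * p \<in> J"
proof (induction p rule: induct)
  case (scalar d)
  show ?case by (simp add: scalar_commute[of d z] J_0)
next
  case (add p q)
  from J_add[OF this] show ?case by (simp add: algebra_simps)
next
  case (mult h p)
  have "h * z - z * h \<in> J"
    using mult z_commute_a z_commute_b z_commute_c by blast
  then have "h * (p * z - z * p) + (h * z - z * h) * p \<in> J"
    using mult(2) by (rule J_add[OF J_lmult J_rmult, rotated])
  then show ?case by (simp add: algebra_simps)
qed

text \<open>Since \<open>z\<close> is central modulo \<open>J\<close>, its annihilator \<open>K\<close> is a two-sided ideal; it contains \<open>a - b\<close>.\<close>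

definition K :: "(generator fword \<Rightarrow>\<^sub>0 'k) set" where
  "K = {q. q * z \<in> J}"

lemma K_add: "p \<in> K \<Longrightarrow> q \<in> K \<Longrightarrow> p + q \<in> K"
  and K_diff: "p \<in> K \<Longrightarrow> q \<in> K \<Longrightarrow> p - q \<in> K"
  and K_lmult: "p \<in> K \<Longrightarrow> r * p \<in> K"
  by (simp_all add: K_def distrib_right left_diff_distrib mult.assoc J_closed)

lemma K_rmult: "p \<in> K \<Longrightarrow> p * r \<in> K"
proof -
  assume "p \<in> K"
  then have "p * (r * z - z * r) + (p * z) * r \<in> J"
    using J_add[OF J_lmult[OF z_commute] J_rmult[of "p * z" r], of p r] by (simp add: K_def)
  then show "p * r \<in> K" by (simp add: K_def algebra_simps)
qed

lemma J_subset_K: "p \<in> J \<Longrightarrow> p \<in> K"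
  by (simp add: K_def J_rmult)

lemma diff_K: "a - b \<in> K"
  by (simp add: K_def diff_mult_z)

lemmas K_closed = K_add K_diff K_lmult K_rmult diff_K squares[THEN J_subset_K] triples[THEN J_subset_K]

text \<open>The general element of the span of \<open>1, a, c, a * c\<close>, the standard basis of
  a Clifford algebra on the two generators \<open>a\<close> and \<open>c\<close>.\<close>

definition comb :: "'k \<Rightarrow> 'k \<Rightarrow> 'k \<Rightarrow> 'k \<Rightarrow> generator fword \<Rightarrow>\<^sub>0 'k" where
  "comb x y v w = scalar x + scalar y * a + scalar v * c + scalar w * (a * c)"

lemma a_mult_comb: "a * comb x y v w - comb (y * \<alpha>\<^sub>1) x (w * \<alpha>\<^sub>1) v \<in> K"
proof -
  have "a * comb x y v w - comb (y * \<alpha>\<^sub>1) x (w * \<alpha>\<^sub>1) v =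
      scalar y * (a * a - scalar \<alpha>\<^sub>1) + scalar w * ((a * a - scalar \<alpha>\<^sub>1) * c)"
    by (simp add: comb_def algebra_simps scalar_simps)
  also have "\<dots> \<in> K" by (intro K_closed)
  finally show ?thesis .
qed

lemma b_mult_comb: "b * comb x y v w - comb (y * \<alpha>\<^sub>1) x (w * \<alpha>\<^sub>1) v \<in> K"
proof -
  have "(a * comb x y v w - comb (y * \<alpha>\<^sub>1) x (w * \<alpha>\<^sub>1) v) - (a - b) * comb x y v w \<in> K"
    by (intro K_diff K_rmult diff_K a_mult_comb)
  then show ?thesis by (simp add: algebra_simps)
qed

lemma c_mult_comb:
  "c * comb x y v w - comb (y * (\<alpha>\<^sub>2 - \<alpha>\<^sub>1) + v * \<alpha>\<^sub>1) (- w * \<alpha>\<^sub>1) (x + w * (\<alpha>\<^sub>2 - \<alpha>\<^sub>1)) (- y) \<in> K"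
proof -
  \<comment> \<open>Modulo \<open>K\<close> the generators \<open>a\<close> and \<open>b\<close>
    agree, so the first triple relation turns into the Clifford relation
    \<open>c * a + a * c = \<alpha>\<^sub>2 - \<alpha>\<^sub>1\<close>, which moves \<open>c\<close>
    past \<open>a\<close>.\<close>
  define k where "k = c * a + a * c - scalar (\<alpha>\<^sub>2 - \<alpha>\<^sub>1)"
  have "k = (c * a + b * c + a * b - scalar \<alpha>\<^sub>2) + (a - b) * c + a * (a - b) - (a * a - scalar \<alpha>\<^sub>1)"
    by (simp add: k_def algebra_simps scalar_diff)
  also have "\<dots> \<in> K" by (intro K_closed)
  finally have k: "k \<in> K" .
  have "c * comb x y v w - comb (y * (\<alpha>\<^sub>2 - \<alpha>\<^sub>1) + v * \<alpha>\<^sub>1) (- w * \<alpha>\<^sub>1) (x + w * (\<alpha>\<^sub>2 - \<alpha>\<^sub>1)) (- y) =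
      scalar y * k + scalar v * (c * c - scalar \<alpha>\<^sub>1) + scalar w * (k * c - a * (c * c - scalar \<alpha>\<^sub>1))"
    by (simp add: comb_def k_def algebra_simps scalar_simps scalar_add scalar_diff scalar_uminus)
  also have "\<dots> \<in> K" by (intro K_closed k)
  finally show ?thesis .
qed

text \<open>The span of \<open>1, a, c, a * c\<close> contains the scalars and is stable modulo
  \<open>K\<close> under left multiplication by generators. Thus the quotient by \<open>K\<close>
  has dimension at most 4.\<close>

lemma span_mod_K: "\<exists>x y v w. p - comb x y v w \<in> K"
proof (induction p rule: induct)
  case (scalar d)
  have "scalar d - comb d 0 0 0 \<in> K"
    by (simp add: comb_def J_subset_K[OF J_0])
  then show ?case by blast
next
  case (add p q)
  then obtain x y v w x' y' v' w' where "p - comb x y v w \<in> K" "q - comb x' y' v' w' \<in> K" by blast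
  from K_add[OF this] have "(p + q) - comb (x + x') (y + y') (v + v') (w + w') \<in> K"
    by (simp add: comb_def algebra_simps scalar_add)
  then show ?case by blast
next
  case (mult h p)
  then obtain x y v w where p: "p - comb x y v w \<in> K" by blast
  have "\<exists>x' y' v' w'. h * comb x y v w - comb x' y' v' w' \<in> K"
    using mult(1) a_mult_comb b_mult_comb c_mult_comb by blast
  then obtain x' y' v' w' where "h * comb x y v w - comb x' y' v' w' \<in> K" by blast
  from K_add[OF K_lmult[OF p, of h] this] have "h * p - comb x' y' v' w' \<in> K"
    by (simp add: algebra_simps)
  then show ?case by blast
qed

end

section \<open>Quotients of free algebras\<close>

lemma ideal_free_algebraI:
  fixes I :: "('g fword \<Rightarrow>\<^sub>0 'k::field) set"
  assumes "0 \<in> I" "\<And>p q. p \<in> I \<Longrightarrow> q \<in> I \<Longrightarrow> p + q \<in> I"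
    and "\<And>p r. p \<in> I \<Longrightarrow> r * p \<in> I" "\<And>p r. p \<in> I \<Longrightarrow> p * r \<in> I"
  shows "ideal I free_algebra"
proof -
  interpret ring "free_algebra :: ('k, 'g fword \<Rightarrow>\<^sub>0 'k) module"
    by (rule ring_free_algebra)
  have minus: "\<ominus>\<^bsub>free_algebra\<^esub> p = - p" for p :: "'g fword \<Rightarrow>\<^sub>0 'k"
    by (rule minus_equality) auto
  have "subgroup I (add_monoid free_algebra)"
  proof (rule add.subgroupI)
    show "\<ominus>\<^bsub>free_algebra\<^esub> p \<in> I" if "p \<in> I" for p
      using assms(3)[OF that, of "- 1"] by (simp add: minus)
  qed (use assms in auto)
  then show ?thesis
    by (intro idealI) (use assms ring_axioms in auto)
qed

lemma quot_algebra_record: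
  "carrier (quot_algebra R I) = a_rcosets\<^bsub>R\<^esub> I" "mult (quot_algebra R I) = rcoset_mult R I"
  "one (quot_algebra R I) = I +>\<^bsub>R\<^esub> \<one>\<^bsub>R\<^esub>" "zero (quot_algebra R I) = I"
  "add (quot_algebra R I) = set_add R"
  "smult (quot_algebra R I) = (\<lambda>c X. \<Union>x\<in>X. I +>\<^bsub>R\<^esub> (c \<odot>\<^bsub>R\<^esub> x))"
  by (simp_all add: quot_algebra_def ring.defs module.defs FactRing_def)

locale free_algebra_ideal =
  fixes J :: "('g fword \<Rightarrow>\<^sub>0 'k::field) set"
  assumes ideal: "ideal J free_algebra"
begin

sublocale ideal J free_algebra
  by (rule ideal)

lemma mem_add: "p \<in> J \<Longrightarrow> q \<in> J \<Longrightarrow> p + q \<in> J"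
  using additive_subgroup.a_closed[OF is_additive_subgroup, of p q] by simp

lemma mem_lmult: "p \<in> J \<Longrightarrow> r * p \<in> J" and mem_rmult: "p \<in> J \<Longrightarrow> p * r \<in> J"
  using I_l_closed[of p r] I_r_closed[of p r] by simp_all

lemma mem_0: "0 \<in> J"
  using additive_subgroup.zero_closed[OF is_additive_subgroup] by simp

lemma mem_uminus: "p \<in> J \<Longrightarrow> - p \<in> J"
  using mem_lmult[of p "- 1"] by simp

abbreviation coset :: "('g fword \<Rightarrow>\<^sub>0 'k) \<Rightarrow> ('g fword \<Rightarrow>\<^sub>0 'k) set" where
  "coset p \<equiv> J +>\<^bsub>free_algebra\<^esub> p"

lemma coset_eq_iff: "coset p = coset q \<longleftrightarrow> p - q \<in> J"
  using quotient_eq_iff_same_a_r_cos[OF ideal, of p q] by simp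

lemma quot_algebra_simps:
  "carrier (quot_algebra free_algebra J) = range coset"
  "one (quot_algebra free_algebra J) = coset 1"
  "zero (quot_algebra free_algebra J) = coset 0"
  "coset p \<oplus>\<^bsub>quot_algebra free_algebra J\<^esub> coset q = coset (p + q)"
  "coset p \<otimes>\<^bsub>quot_algebra free_algebra J\<^esub> coset q = coset (p * q)"
  "d \<odot>\<^bsub>quot_algebra free_algebra J\<^esub> coset p = coset (scalar d * p)"
proof -
  show "carrier (quot_algebra free_algebra J) = range coset"
    unfolding quot_algebra_record A_RCOSETS_def' by auto
  show "zero (quot_algebra free_algebra J) = coset 0"
    using a_coset_add_zero[OF a_subset] by (simp add: quot_algebra_record)
  show "coset p \<oplus>\<^bsub>quot_algebra free_algebra J\<^esub> coset q = coset (p + q)"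
    using a_rcos_sum[of p q] by (simp add: quot_algebra_record)
  show "coset p \<otimes>\<^bsub>quot_algebra free_algebra J\<^esub> coset q = coset (p * q)"
    using rcoset_mult_add[of p q] by (simp add: quot_algebra_record)
  \<comment> \<open>All cosets in the union that defines the scalar multiplication coincide.\<close>
  have "coset (scalar d * q) = coset (scalar d * p)" if "q \<in> coset p" for q
  proof -
    have "q - p \<in> J" using that by (auto simp: a_r_coset_def')
    then show ?thesis using mem_lmult[of "q - p" "scalar d"] by (simp add: coset_eq_iff right_diff_distrib)
  qed
  moreover have "p \<in> coset p" using a_rcos_self[of p] by simp
  ultimately have "(\<Union>q\<in>coset p. coset (scalar d * q)) = coset (scalar d * p)" by blast
  then show "d \<odot>\<^bsub>quot_algebra free_algebra J\<^esub> coset p = coset (scalar d * p)"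
    by (simp add: quot_algebra_record)
qed (simp add: quot_algebra_record)

lemma ring_quot_algebra: "ring (quot_algebra free_algebra J)"
  using quotient_is_ring ring_cong[of "quot_algebra free_algebra J" "free_algebra Quot J"]
  by (simp add: quot_algebra_record FactRing_def)

lemma ideal_quot_algebra:
  assumes "ideal I free_algebra"
  shows "ideal (coset ` I) (quot_algebra free_algebra J)"
proof -
  interpret Q: ring "quot_algebra free_algebra J" by (rule ring_quot_algebra)
  interpret I: free_algebra_ideal I by (rule free_algebra_ideal.intro) fact
  have uminus: "\<ominus>\<^bsub>quot_algebra free_algebra J\<^esub> coset p = coset (- p)" for p
    by (rule Q.minus_equality) (auto simp: quot_algebra_simps)
  have "subgroup (coset ` I) (add_monoid (quot_algebra free_algebra J))"
  proof (rule Q.add.subgroupI)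
    show "\<ominus>\<^bsub>quot_algebra free_algebra J\<^esub> X \<in> coset ` I" if "X \<in> coset ` I" for X
      using that by (auto simp: uminus I.mem_uminus)
  qed (use I.mem_0 in \<open>auto simp: quot_algebra_simps I.mem_add\<close>)
  then show ?thesis
    by (intro idealI ring_quot_algebra)
      (auto simp: quot_algebra_simps I.mem_lmult I.mem_rmult)
qed

text \<open>The images of \<open>I\<close> and \<open>N\<close> in the quotient satisfy the
  hypotheses of \<open>semisimple_square_zero_ideal\<close>; because \<open>J \<subseteq> I\<close>,
  membership in the image of \<open>I\<close> lifts back to membership in \<open>I\<close>.\<close>

lemma not_semisimple_quot_algebra:
  assumes IN: "ideal I free_algebra" "ideal N free_algebra" "J \<subseteq> I"
    and square: "\<And>p q. p \<in> N \<Longrightarrow> q \<in> N \<Longrightarrow> p * q \<in> I"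
    and "p \<in> N" "p \<notin> I"
  shows "\<not> semisimple (quot_algebra free_algebra J)"
proof
  interpret I: free_algebra_ideal I by (rule free_algebra_ideal.intro) fact
  assume "semisimple (quot_algebra free_algebra J)"
  then have "coset ` N \<subseteq> coset ` I"
    by (rule semisimple_square_zero_ideal)
      (use square in \<open>auto intro: ideal_quot_algebra IN simp: quot_algebra_simps\<close>)
  then obtain q where "q \<in> I" "coset p = coset q" using \<open>p \<in> N\<close> by blast
  then have "(p - q) + q \<in> I" using IN(3) by (intro I.mem_add) (auto simp: coset_eq_iff)
  then show False using \<open>p \<notin> I\<close> by simp
qed

text \<open>The idempotent criterion expressed through representatives, so that every condition
  becomes a membership in \<open>J\<close>.\<close>

lemma semisimple_quot_algebra:
  assumes A: "finite A" and e: "\<And>i. i \<in> A \<Longrightarrow> e i \<notin> J"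
    and orth: "\<And>i j. i \<in> A \<Longrightarrow> j \<in> A \<Longrightarrow> e i * e j - (if i = j then e i else 0) \<in> J"
    and one: "(\<Sum>i\<in>A. e i) - 1 \<in> J"
    and simple: "\<And>i p. i \<in> A \<Longrightarrow> p * e i \<notin> J \<Longrightarrow> \<exists>q. q * (p * e i) - e i \<in> J"
  shows "semisimple (quot_algebra free_algebra J)"
proof -
  interpret Q: ring "quot_algebra free_algebra J" by (rule ring_quot_algebra)
  have coset_0: "coset p = coset 0 \<longleftrightarrow> p \<in> J" for p
    by (simp add: coset_eq_iff)
  show ?thesis
  proof (rule Q.semisimple_if_orthogonal_idempotents[of A "\<lambda>i. coset (e i)"])
    show "coset (e i) \<otimes>\<^bsub>quot_algebra free_algebra J\<^esub> coset (e j) =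
        (if i = j then coset (e i) else \<zero>\<^bsub>quot_algebra free_algebra J\<^esub>)" if "i \<in> A" "j \<in> A" for i j
      using orth[OF that] by (auto simp: quot_algebra_simps coset_eq_iff)
    have "finsum (quot_algebra free_algebra J) (\<lambda>i. coset (e i)) A = coset (\<Sum>i\<in>A. e i)"
      using A by (induction A) (auto simp: quot_algebra_simps Q.finsum_insert)
    then show "finsum (quot_algebra free_algebra J) (\<lambda>i. coset (e i)) A =
        \<one>\<^bsub>quot_algebra free_algebra J\<^esub>"
      using one by (simp add: quot_algebra_simps coset_eq_iff)
    fix i X assume i: "i \<in> A" and "X \<in> carrier (quot_algebra free_algebra J)"
      and X: "X \<otimes>\<^bsub>quot_algebra free_algebra J\<^esub> coset (e i) \<noteq> \<zero>\<^bsub>quot_algebra free_algebra J\<^esub>"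
    then obtain p where p: "X = coset p" by (auto simp: quot_algebra_simps)
    with X have "p * e i \<notin> J" by (simp add: quot_algebra_simps coset_0)
    then obtain q where "q * (p * e i) - e i \<in> J" using simple i by blast
    then show "\<exists>Y\<in>carrier (quot_algebra free_algebra J).
        Y \<otimes>\<^bsub>quot_algebra free_algebra J\<^esub> (X \<otimes>\<^bsub>quot_algebra free_algebra J\<^esub> coset (e i)) = coset (e i)"
      by (intro bexI[of _ "coset q"]) (auto simp: p quot_algebra_simps coset_eq_iff)
  qed (use A e in \<open>auto simp: quot_algebra_simps coset_0\<close>)
qed

end

section \<open>The Clifford representation: kernel and image\<close>

text \<open>The images of \<open>1, a, c, a * c\<close> form a basis of the matrices since
  \<open>\<Delta> \<noteq> 0\<close>. They span modulo \<open>K\<close>, and \<open>K\<close> is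
  mapped to 0 because \<open>z\<close> is mapped to an invertible scalar. So the kernel is contained
  in \<open>K\<close>.\<close>

lemma (in D3_relations) clifford_rep:
  assumes f: "m2_eval f a = M2 0 1 \<alpha>\<^sub>1 0" "m2_eval f b = M2 0 1 \<alpha>\<^sub>1 0"
      "m2_eval f c = M2 r 0 (\<alpha>\<^sub>2 - \<alpha>\<^sub>1) (- r)"
    and r: "r * r = \<alpha>\<^sub>1" and nondeg: "(3 * \<alpha>\<^sub>1 - \<alpha>\<^sub>2) * (\<alpha>\<^sub>1 + \<alpha>\<^sub>2) \<noteq> 0"
    and J: "\<And>p. p \<in> J \<Longrightarrow> m2_eval f p = 0"
  shows clifford_rep_kernel: "m2_eval f p = 0 \<Longrightarrow> p * z \<in> J"
    and clifford_rep_surj: "\<exists>p. m2_eval f p = M"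
proof -
  have z: "m2_eval f z = m2_scalar (3 * \<alpha>\<^sub>1 - \<alpha>\<^sub>2)"
    by (simp add: z_def f m2_scalar_def m2_defs)
  define \<beta> where "\<beta> = \<alpha>\<^sub>2 - \<alpha>\<^sub>1"
  \<comment> \<open>In the equations for \<open>m2_eval f (comb x y v w) = M\<close>, the entries 22
    and 12 determine \<open>x\<close> and \<open>y\<close>. What remains is a system of two
    equations in \<open>v\<close> and \<open>w\<close> with determinant
    \<open>- \<Delta>\<close>.\<close>
  define \<Delta> where "\<Delta> = \<beta> * \<beta> - 4 * \<alpha>\<^sub>1 * \<alpha>\<^sub>1"
  have "\<Delta> = - ((3 * \<alpha>\<^sub>1 - \<alpha>\<^sub>2) * (\<alpha>\<^sub>1 + \<alpha>\<^sub>2))"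
    by (simp add: \<Delta>_def \<beta>_def algebra_simps)
  then have \<Delta>: "\<Delta> \<noteq> 0" using nondeg by simp
  have comb: "m2_eval f (comb x y v w) =
      M2 (x + v * r + w * \<beta>) (y - w * r) (y * \<alpha>\<^sub>1 + v * \<beta> + w * r * \<alpha>\<^sub>1) (x - v * r)" for x y v w
    by (simp add: comb_def f m2_scalar_def m2_defs \<beta>_def algebra_simps)
  show "p * z \<in> J" if p: "m2_eval f p = 0"
  proof -
    have K: "m2_eval f q = 0" if "q \<in> K" for q
    proof -
      have "m2_eval f q * m2_scalar (3 * \<alpha>\<^sub>1 - \<alpha>\<^sub>2) = 0"
        using J[of "q * z"] that by (simp add: K_def z)
      then show ?thesis
        using nondeg by (cases "m2_eval f q") (simp add: m2_scalar_def m2_defs)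
    qed
    obtain x y v w where xyvw: "p - comb x y v w \<in> K" using span_mod_K by blast
    then have "m2_eval f (comb x y v w) = 0" using K[OF xyvw] p by simp
    then have eq: "x + v * r + w * \<beta> = 0 \<and> y - w * r = 0 \<and> y * \<alpha>\<^sub>1 + v * \<beta> + w * r * \<alpha>\<^sub>1 = 0 \<and> x - v * r = 0"
      unfolding comb zero_m2_def m2.inject .
    have 1: "x + v * r + w * \<beta> = 0" and 2: "y = w * r" and 3: "y * \<alpha>\<^sub>1 + v * \<beta> + w * r * \<alpha>\<^sub>1 = 0"
      and 4: "x = v * r"
      using eq by (blast, simp, blast, simp)
    have "\<Delta> * w = 0"
    proof -
      have "\<Delta> * w = \<beta> * (x + v * r + w * \<beta>) - 2 * r * (y * \<alpha>\<^sub>1 + v * \<beta> + w * r * \<alpha>\<^sub>1)"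
        unfolding 2 4 \<Delta>_def by (simp add: r[symmetric] algebra_simps)
      then show ?thesis using 1 3 by simp
    qed
    then have w: "w = 0" using \<Delta> by simp
    have "\<Delta> * v = 0"
    proof -
      have "\<Delta> * v = \<beta> * (y * \<alpha>\<^sub>1 + v * \<beta> + w * r * \<alpha>\<^sub>1) - 2 * r * \<alpha>\<^sub>1 * (x + v * r + w * \<beta>)"
        unfolding 2 4 \<Delta>_def by (simp add: r[symmetric] algebra_simps)
      then show ?thesis using 1 3 by simp
    qed
    then have "v = 0" using \<Delta> by simp
    then show ?thesis using xyvw 2 4 w by (simp add: comb_def K_def)
  qed
  show "\<exists>p. m2_eval f p = M"
  proof
    \<comment> \<open>\<open>d\<close> and \<open>l\<close> are the right-hand sides after
      eliminating \<open>x\<close> and \<open>y\<close>; \<open>v\<close> and \<open>w\<close> come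
      from Cramer's rule.\<close>
    define d where "d = m11 M - m22 M"
    define l where "l = m21 M - \<alpha>\<^sub>1 * m12 M"
    define v where "v = (\<beta> * l - 2 * \<alpha>\<^sub>1 * r * d) / \<Delta>"
    define w where "w = (\<beta> * d - 2 * r * l) / \<Delta>"
    have "\<Delta> * (2 * r * v + \<beta> * w) = \<Delta> * d"
    proof -
      have "\<Delta> * (2 * r * v + \<beta> * w) = 2 * r * (\<beta> * l - 2 * \<alpha>\<^sub>1 * r * d) + \<beta> * (\<beta> * d - 2 * r * l)"
        using \<Delta> by (simp add: v_def w_def distrib_left)
      then show ?thesis unfolding \<Delta>_def by (simp add: r[symmetric] algebra_simps)
    qed
    then have d: "2 * r * v + \<beta> * w = d" using \<Delta> by simp
    have "\<Delta> * (\<beta> * v + 2 * \<alpha>\<^sub>1 * r * w) = \<Delta> * l"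
    proof -
      have "\<Delta> * (\<beta> * v + 2 * \<alpha>\<^sub>1 * r * w) =
          \<beta> * (\<beta> * l - 2 * \<alpha>\<^sub>1 * r * d) + 2 * \<alpha>\<^sub>1 * r * (\<beta> * d - 2 * r * l)"
        using \<Delta> by (simp add: v_def w_def distrib_left)
      then show ?thesis unfolding \<Delta>_def by (simp add: r[symmetric] algebra_simps)
    qed
    then have l: "\<beta> * v + 2 * \<alpha>\<^sub>1 * r * w = l" using \<Delta> by simp
    show "m2_eval f (comb (m22 M + v * r) (m12 M + w * r) v w) = M"
      using d l unfolding comb d_def l_def by (cases M) (simp add: algebra_simps)
  qed
qed

section \<open>Representations of \<open>\<D>\<^sub>3\<close>\<close>

text \<open>The generator \<open>i\<close> is singled out and the other two share one matrix;
  \<open>r\<close> stands for a square root of \<open>\<alpha>\<^sub>1\<close>.\<close>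

definition D3_rep :: "'k::field \<Rightarrow> 'k \<Rightarrow> 'k \<Rightarrow> generator \<Rightarrow> generator \<Rightarrow> 'k m2" where
  "D3_rep \<alpha>\<^sub>1 \<alpha>\<^sub>2 r i g = (if g = i then M2 r 0 (\<alpha>\<^sub>2 - \<alpha>\<^sub>1) (- r) else M2 0 1 \<alpha>\<^sub>1 0)"

definition m2_unit :: "bool \<Rightarrow> 'k::field m2" where
  "m2_unit k = (if k then M2 1 0 0 0 else M2 0 0 0 1)"

text \<open>Multiplying by \<open>m2_unit k\<close> keeps one column of \<open>M\<close>. A non-zero
  entry of it can be moved to the diagonal and scaled to 1, and the other entry dropped, by a
  multiple of a matrix unit.\<close>

lemma m2_unit_simple:
  assumes "M * m2_unit k \<noteq> 0"
  shows "\<exists>N. N * (M * m2_unit k) = m2_unit k"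
proof (cases k)
  case True
  show ?thesis
  proof (cases "m11 M = 0")
    case False
    then show ?thesis using True
      by (intro exI[of _ "M2 (1 / m11 M) 0 0 0"]) (simp add: m2_unit_def m2_defs)
  next
    case 0: True
    then show ?thesis using True assms
      by (intro exI[of _ "M2 0 (1 / m21 M) 0 0"]) (simp add: m2_unit_def m2_defs)
  qed
next
  case False
  show ?thesis
  proof (cases "m12 M = 0")
    case 0: False
    then show ?thesis using False
      by (intro exI[of _ "M2 0 0 (1 / m12 M) 0"]) (simp add: m2_unit_def m2_defs)
  next
    case True
    then show ?thesis using False assms
      by (intro exI[of _ "M2 0 0 0 (1 / m22 M)"]) (simp add: m2_unit_def m2_defs)
  qed
qed

abbreviation D3_ideal :: "'k::field \<Rightarrow> 'k \<Rightarrow> (generator fword \<Rightarrow>\<^sub>0 'k) set" where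
  "D3_ideal \<alpha>\<^sub>1 \<alpha>\<^sub>2 \<equiv> Idl\<^bsub>free_algebra\<^esub> (D3_relators \<alpha>\<^sub>1 \<alpha>\<^sub>2)"

lemma UNIV_generator: "UNIV = {Gen_a, Gen_b, Gen_c}"
  using generator.exhaust by auto

instance generator :: finite
  by standard (simp add: UNIV_generator)

lemma ideal_D3_ideal: "ideal (D3_ideal \<alpha>\<^sub>1 \<alpha>\<^sub>2) free_algebra"
  by (rule ring.genideal_ideal[OF ring_free_algebra]) simp

lemma D3_relations_D3_ideal:
  "D3_relations (D3_ideal \<alpha>\<^sub>1 \<alpha>\<^sub>2) \<alpha>\<^sub>1 \<alpha>\<^sub>2 (gen Gen_a) (gen Gen_b) (gen Gen_c)"
proof -
  interpret J: free_algebra_ideal "D3_ideal \<alpha>\<^sub>1 \<alpha>\<^sub>2"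
    by (rule free_algebra_ideal.intro) (rule ideal_D3_ideal)
  have "D3_relators \<alpha>\<^sub>1 \<alpha>\<^sub>2 \<subseteq> D3_ideal \<alpha>\<^sub>1 \<alpha>\<^sub>2"
    by (rule J.genideal_self) simp
  then have relators: "p \<in> D3_ideal \<alpha>\<^sub>1 \<alpha>\<^sub>2" if "p \<in> D3_relators \<alpha>\<^sub>1 \<alpha>\<^sub>2" for p
    using that by blast
  show ?thesis
  proof
    show "range gen = {gen Gen_a, gen Gen_b, gen Gen_c}"
      by (simp add: UNIV_generator)
  qed (fact J.mem_add J.mem_uminus J.mem_lmult J.mem_rmult
    | rule relators, simp add: D3_relators_def Let_def)+
qed

lemma ideal_m2_eval_kernel: "ideal {p. m2_eval f p = 0} free_algebra"
  by (rule ideal_free_algebraI) auto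

lemma m2_eval_D3_ideal:
  assumes "\<And>p. p \<in> D3_relators \<alpha>\<^sub>1 \<alpha>\<^sub>2 \<Longrightarrow> m2_eval f p = 0" "p \<in> D3_ideal \<alpha>\<^sub>1 \<alpha>\<^sub>2"
  shows "m2_eval f p = 0"
  using ring.genideal_minimal[OF ring_free_algebra ideal_m2_eval_kernel, of "D3_relators \<alpha>\<^sub>1 \<alpha>\<^sub>2" f]
    assms by blast

lemma m2_eval_D3_rep:
  assumes "r * r = \<alpha>\<^sub>1" "p \<in> D3_ideal \<alpha>\<^sub>1 \<alpha>\<^sub>2"
  shows "m2_eval (D3_rep \<alpha>\<^sub>1 \<alpha>\<^sub>2 r i) p = 0"
proof (rule m2_eval_D3_ideal[OF _ assms(2)])
  show "m2_eval (D3_rep \<alpha>\<^sub>1 \<alpha>\<^sub>2 r i) p = 0" if "p \<in> D3_relators \<alpha>\<^sub>1 \<alpha>\<^sub>2" for p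
    using that assms(1)
    by (cases i) (auto simp: D3_relators_def Let_def D3_rep_def m2_scalar_def m2_defs)
qed

section \<open>The non-degenerate case: splitting into three matrix blocks\<close>

locale D3_nondegenerate =
  fixes \<alpha>\<^sub>1 \<alpha>\<^sub>2 r :: "'k::field"
  assumes r: "r * r = \<alpha>\<^sub>1" and nondeg: "(3 * \<alpha>\<^sub>1 - \<alpha>\<^sub>2) * (\<alpha>\<^sub>1 + \<alpha>\<^sub>2) \<noteq> 0"
begin

abbreviation "J \<equiv> D3_ideal \<alpha>\<^sub>1 \<alpha>\<^sub>2"

sublocale free_algebra_ideal J
  by (rule free_algebra_ideal.intro) (rule ideal_D3_ideal)

text \<open>The three interpretations are named after their third generator, the one that does not
  occur in the respective \<open>z\<close>.\<close>

interpretation C: D3_relations J \<alpha>\<^sub>1 \<alpha>\<^sub>2 "gen Gen_a" "gen Gen_b" "gen Gen_c"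
  by (rule D3_relations_D3_ideal)

interpretation A: D3_relations J \<alpha>\<^sub>1 \<alpha>\<^sub>2 "gen Gen_b" "gen Gen_c" "gen Gen_a"
  by (rule C.rotate)

interpretation B: D3_relations J \<alpha>\<^sub>1 \<alpha>\<^sub>2 "gen Gen_c" "gen Gen_a" "gen Gen_b"
  by (rule A.rotate)

definition rep :: "generator \<Rightarrow> (generator fword \<Rightarrow>\<^sub>0 'k) \<Rightarrow> 'k m2" where
  "rep i = m2_eval (D3_rep \<alpha>\<^sub>1 \<alpha>\<^sub>2 r i)"

definition zs :: "generator \<Rightarrow> (generator fword \<Rightarrow>\<^sub>0 'k)" where
  "zs i = (case i of Gen_a \<Rightarrow> A.z | Gen_b \<Rightarrow> B.z | Gen_c \<Rightarrow> C.z)"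

lemma rep_hom [simp]:
  "rep i (p + q) = rep i p + rep i q" "rep i (p - q) = rep i p - rep i q"
  "rep i (p * q) = rep i p * rep i q" "rep i 0 = 0" "rep i 1 = 1" "rep i (scalar d) = m2_scalar d"
  "rep i (sum h X) = (\<Sum>x\<in>X. rep i (h x))"
  by (simp_all add: rep_def)

text \<open>For \<open>i = j\<close> both generators in \<open>zs j\<close> go to the same matrix of
  square \<open>\<alpha>\<^sub>1\<close>; otherwise \<open>zs j\<close> is the Clifford relation
  that the two different matrices satisfy.\<close>

lemma rep_zs: "rep i (zs j) = (if i = j then m2_scalar (3 * \<alpha>\<^sub>1 - \<alpha>\<^sub>2) else 0)"
  using r
  by (cases i; cases j)
    (simp_all add: rep_def zs_def A.z_def B.z_def C.z_def D3_rep_def m2_scalar_def m2_defs)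

lemma rep_J: "p \<in> J \<Longrightarrow> rep i p = 0"
  unfolding rep_def by (rule m2_eval_D3_rep[OF r])

lemma rep_kernel: "rep i p = 0 \<Longrightarrow> p * zs i \<in> J"
  using A.clifford_rep_kernel[of "D3_rep \<alpha>\<^sub>1 \<alpha>\<^sub>2 r i" r p] B.clifford_rep_kernel[of "D3_rep \<alpha>\<^sub>1 \<alpha>\<^sub>2 r i" r p]
    C.clifford_rep_kernel[of "D3_rep \<alpha>\<^sub>1 \<alpha>\<^sub>2 r i" r p] r nondeg rep_J
  by (cases i) (simp_all add: rep_def zs_def D3_rep_def)

lemma rep_surj: "\<exists>p. rep i p = M"
  using A.clifford_rep_surj[of "D3_rep \<alpha>\<^sub>1 \<alpha>\<^sub>2 r i" r M] B.clifford_rep_surj[of "D3_rep \<alpha>\<^sub>1 \<alpha>\<^sub>2 r i" r M]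
    C.clifford_rep_surj[of "D3_rep \<alpha>\<^sub>1 \<alpha>\<^sub>2 r i" r M] r nondeg rep_J
  by (cases i) (simp_all add: rep_def D3_rep_def)

text \<open>If every representation kills \<open>p\<close>, then \<open>p * zs i \<in> J\<close> for
  all \<open>i\<close>. The three \<open>zs i\<close> add up to the invertible scalar
  \<open>3 * \<alpha>\<^sub>1 - \<alpha>\<^sub>2\<close> modulo \<open>J\<close>, so
  \<open>p \<in> J\<close>.\<close>

lemma J_iff: "p \<in> J \<longleftrightarrow> (\<forall>i. rep i p = 0)"
proof
  assume p: "\<forall>i. rep i p = 0"
  define D where "D = 3 * \<alpha>\<^sub>1 - \<alpha>\<^sub>2"
  have D: "D \<noteq> 0" using nondeg by (simp add: D_def)
  have "scalar D - (zs Gen_a + zs Gen_b + zs Gen_c) =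
      - ((gen Gen_c * gen Gen_a + gen Gen_b * gen Gen_c + gen Gen_a * gen Gen_b - scalar \<alpha>\<^sub>2) +
        (gen Gen_c * gen Gen_b + gen Gen_b * gen Gen_a + gen Gen_a * gen Gen_c - scalar \<alpha>\<^sub>2))"
  proof -
    have "scalar D = scalar \<alpha>\<^sub>1 + scalar \<alpha>\<^sub>1 + scalar \<alpha>\<^sub>1 - scalar \<alpha>\<^sub>2"
      by (simp add: D_def scalar_add[symmetric] scalar_diff[symmetric])
    then show ?thesis
      by (simp add: zs_def A.z_def B.z_def C.z_def algebra_simps)
  qed
  also have "\<dots> \<in> J"
    by (intro mem_uminus mem_add C.triples)
  finally have "p * (scalar D - (zs Gen_a + zs Gen_b + zs Gen_c)) +
      (p * zs Gen_a + p * zs Gen_b + p * zs Gen_c) \<in> J"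
    by (intro mem_add mem_lmult rep_kernel) (use p in auto)
  then have "p * scalar D \<in> J"
    by (simp add: algebra_simps)
  then have "p * scalar D * scalar (1 / D) \<in> J"
    by (rule mem_rmult)
  then show "p \<in> J"
    using D by (simp add: mult.assoc scalar_mult[symmetric])
qed (simp add: rep_J)

text \<open>As in the Chinese remainder theorem: preimages for the single blocks are glued by the
  orthogonal elements \<open>zs j\<close>, divided by
  \<open>3 * \<alpha>\<^sub>1 - \<alpha>\<^sub>2\<close>.\<close>

lemma reps_surj: "\<exists>p. \<forall>i. rep i p = M i"
proof -
  define q where "q i = (SOME p. rep i p = M i)" for i
  have q: "rep i (q i) = M i" for i
    unfolding q_def by (rule someI_ex) (rule rep_surj)
  define D where "D = 3 * \<alpha>\<^sub>1 - \<alpha>\<^sub>2"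
  have D: "D \<noteq> 0" using nondeg by (simp add: D_def)
  have inverse: "m2_scalar (1 / D) * (N * m2_scalar D) = N" for N
    using D by (cases N) (simp add: m2_scalar_def m2_defs)
  have "rep i (scalar (1 / D) * (\<Sum>j\<in>UNIV. q j * zs j)) = M i" for i
    by (simp add: rep_zs q D_def[symmetric] inverse if_distrib sum.delta cong: if_cong)
  then show ?thesis by blast
qed

lemma semisimple_D3: "semisimple (D3 \<alpha>\<^sub>1 \<alpha>\<^sub>2)"
proof -
  \<comment> \<open>The six idempotents lift the two diagonal matrix units of each of the three
    blocks. By \<open>J_iff\<close> all conditions on them can be checked on matrices.\<close>
  define e where "e = (\<lambda>(i, k). SOME p. \<forall>j. rep j p = (if j = i then m2_unit k else 0))"
  have e: "rep j (e (i, k)) = (if j = i then m2_unit k else 0)" for i j k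
    using someI_ex[OF reps_surj[of "\<lambda>j. if j = i then m2_unit k else 0"]] by (simp add: e_def)
  have unit: "m2_unit k * m2_unit l = (if k = l then m2_unit k else 0)" "m2_unit k \<noteq> (0 :: 'k m2)"
    "m2_unit False + m2_unit True = (1 :: 'k m2)" for k l
    by (simp_all add: m2_unit_def m2_defs)
  show ?thesis
    unfolding D3_def
  proof (rule semisimple_quot_algebra)
    show "finite (UNIV :: (generator \<times> bool) set)" by simp
    show "e x \<notin> J" for x
      by (cases x) (auto simp: J_iff e unit)
    show "e x * e y - (if x = y then e x else 0) \<in> J" for x y
      by (cases x; cases y) (auto simp: J_iff e unit)
    have "(\<Sum>x\<in>UNIV. rep j (e x)) = 1" for j
    proof -
      have "(\<Sum>x\<in>UNIV. rep j (e x)) = (\<Sum>i\<in>UNIV. \<Sum>k\<in>UNIV. rep j (e (i, k)))"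
        by (simp add: sum.cartesian_product)
      also have "\<dots> = (\<Sum>i\<in>UNIV. if j = i then 1 else 0)"
        by (rule sum.cong) (simp_all add: e UNIV_bool unit)
      finally show ?thesis by simp
    qed
    then show "(\<Sum>x\<in>UNIV. e x) - 1 \<in> J"
      by (simp add: J_iff)
    fix x p assume "p * e x \<notin> J"
    obtain i k where x: "x = (i, k)" by (cases x)
    from \<open>p * e x \<notin> J\<close> have "rep i p * m2_unit k \<noteq> 0"
      by (auto simp: J_iff x e split: if_splits)
    then obtain N where N: "N * (rep i p * m2_unit k) = m2_unit k"
      using m2_unit_simple by blast
    obtain q where "rep i q = N" using rep_surj by blast
    with N have "q * (p * e x) - e x \<in> J"
      by (simp add: J_iff x e)
    then show "\<exists>q. q * (p * e x) - e x \<in> J" by blast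
  qed
qed

end

section \<open>The degenerate case\<close>

lemma not_semisimple_D3:
  fixes \<alpha>\<^sub>1 \<alpha>\<^sub>2 r \<epsilon> :: "'k::field"
  assumes r: "r * r = \<alpha>\<^sub>1" and \<epsilon>: "\<epsilon> * \<epsilon> = 1" and \<alpha>\<^sub>2: "\<alpha>\<^sub>2 = \<alpha>\<^sub>1 + 2 * \<epsilon> * \<alpha>\<^sub>1"
  shows "\<not> semisimple (D3 \<alpha>\<^sub>1 \<alpha>\<^sub>2)"
proof -
  \<comment> \<open>The generators \<open>a\<close> and \<open>b\<close> go to a diagonal matrix
    \<open>A\<close> of square \<open>\<alpha>\<^sub>1\<close>, and \<open>c\<close> to
    \<open>\<epsilon>\<close> times \<open>A\<close> plus the matrix unit at position 12. This unit
    anticommutes with \<open>A\<close> and has square zero, so it disturbs neither the square of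
    \<open>c\<close> nor its anticommutator with \<open>A\<close>, which is
    \<open>2 * \<epsilon> * \<alpha>\<^sub>1\<close>.\<close>
  define f where "f = (\<lambda>g. if g = Gen_c then M2 (\<epsilon> * r) 1 0 (- \<epsilon> * r) else M2 r 0 0 (- r))"
  have upper: "m21 (m2_eval f p) = 0" for p
  proof (induction p rule: free_algebra_induct)
    case (gen g p)
    then show ?case by (simp add: f_def m2_defs)
  qed (simp_all add: m2_scalar_def m2_defs)
  have \<epsilon>': "\<epsilon> * (\<epsilon> * x) = x" for x
    using \<epsilon> by (simp add: mult.assoc[symmetric])
  have relators: "m2_eval f p = 0" if "p \<in> D3_relators \<alpha>\<^sub>1 \<alpha>\<^sub>2" for p
    using that unfolding D3_relators_def Let_def
    by (elim insertE emptyE; hypsubst)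
      (simp_all add: f_def m2_scalar_def m2_defs \<alpha>\<^sub>2 r[symmetric] \<epsilon>' algebra_simps)
  define N where "N = {p. m11 (m2_eval f p) = 0 \<and> m22 (m2_eval f p) = 0}"
  interpret J: free_algebra_ideal "D3_ideal \<alpha>\<^sub>1 \<alpha>\<^sub>2"
    by (rule free_algebra_ideal.intro) (rule ideal_D3_ideal)
  show ?thesis
    unfolding D3_def
  proof (rule J.not_semisimple_quot_algebra)
    show "ideal {p. m2_eval f p = 0} free_algebra" by (rule ideal_m2_eval_kernel)
    show "ideal N free_algebra"
      by (rule ideal_free_algebraI) (simp_all add: N_def m2_defs upper)
    show "D3_ideal \<alpha>\<^sub>1 \<alpha>\<^sub>2 \<subseteq> {p. m2_eval f p = 0}"
      using m2_eval_D3_ideal relators by blast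
    show "p * q \<in> {p. m2_eval f p = 0}" if "p \<in> N" "q \<in> N" for p q
      using that by (simp add: N_def m2_defs upper)
    \<comment> \<open>This element is mapped exactly to the matrix unit at position 12, which is
      non-zero even for \<open>r = 0\<close>.\<close>
    show "gen Gen_c - scalar \<epsilon> * gen Gen_a \<in> N" "gen Gen_c - scalar \<epsilon> * gen Gen_a \<notin> {p. m2_eval f p = 0}"
      by (simp_all add: N_def f_def m2_scalar_def m2_defs)
  qed
qed

section \<open>Transfer to the matrix algebra and the isomorphism\<close>

definition m2_mat :: "'k::field m2 \<Rightarrow> 'k mat" where
  "m2_mat M = mat 2 2 (\<lambda>(i, j).
     if i = 0 then if j = 0 then m11 M else m12 M else if j = 0 then m21 M else m22 M)"

lemma m2_mat_carrier [simp]: "m2_mat M \<in> carrier_mat 2 2"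
  by (simp add: m2_mat_def)

text \<open>The last identity is what compatibility with scalars needs: in the quotient
  \<open>d\<close> acts as multiplication by \<open>scalar d\<close>, which is represented by a
  scalar matrix.\<close>

lemma m2_mat_hom:
  "m2_mat (M + N) = m2_mat M + m2_mat N" "m2_mat (M * N) = m2_mat M * m2_mat N"
  "m2_mat 1 = 1\<^sub>m 2" "m2_mat (m2_scalar d) * m2_mat M = d \<cdot>\<^sub>m m2_mat M"
  by (rule eq_matI;
    auto simp: m2_mat_def m2_defs m2_scalar_def scalar_prod_def numeral_2_eq_2 less_Suc_eq)+

lemma m2_mat_inject: "m2_mat M = m2_mat N \<longleftrightarrow> M = N"
proof
  assume "m2_mat M = m2_mat N"
  then have "m2_mat M $$ (i, j) = m2_mat N $$ (i, j)" for i j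
    by simp
  from this[of 0 0] this[of 0 1] this[of 1 0] this[of 1 1] show "M = N"
    by (cases M; cases N) (simp add: m2_mat_def)
qed simp

lemma m2_mat_surj:
  assumes "X \<in> carrier_mat 2 2"
  shows "\<exists>M. m2_mat M = X"
proof
  show "m2_mat (M2 (X $$ (0, 0)) (X $$ (0, 1)) (X $$ (1, 0)) (X $$ (1, 1))) = X"
    by (rule eq_matI) (use assms in \<open>auto simp: m2_mat_def numeral_2_eq_2 less_Suc_eq\<close>)
qed

lemma prod_algebra_simps:
  "carrier (prod_algebra R S) = carrier R \<times> carrier S"
  "one (prod_algebra R S) = (\<one>\<^bsub>R\<^esub>, \<one>\<^bsub>S\<^esub>)"
  "(x, y) \<otimes>\<^bsub>prod_algebra R S\<^esub> (x', y') = (x \<otimes>\<^bsub>R\<^esub> x', y \<otimes>\<^bsub>S\<^esub> y')"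
  "(x, y) \<oplus>\<^bsub>prod_algebra R S\<^esub> (x', y') = (x \<oplus>\<^bsub>R\<^esub> x', y \<oplus>\<^bsub>S\<^esub> y')"
  "d \<odot>\<^bsub>prod_algebra R S\<^esub> (x, y) = (d \<odot>\<^bsub>R\<^esub> x, d \<odot>\<^bsub>S\<^esub> y)"
  by (simp_all add: prod_algebra_def RDirProd_def DirProd_def monoid.defs ring.defs module.defs)

context D3_nondegenerate
begin

definition mat_rep :: "(generator fword \<Rightarrow>\<^sub>0 'k) \<Rightarrow> 'k mat \<times> 'k mat \<times> 'k mat" where
  "mat_rep p = (m2_mat (rep Gen_a p), m2_mat (rep Gen_b p), m2_mat (rep Gen_c p))"

text \<open>By \<open>J_iff\<close> the common kernel of the three representations is
  \<open>J\<close>; the two directions make the induced map on cosets injective and well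
  defined.\<close>

lemma mat_rep_eq_iff: "mat_rep p = mat_rep q \<longleftrightarrow> coset p = coset q"
proof -
  have "(\<forall>i. P i) \<longleftrightarrow> P Gen_a \<and> P Gen_b \<and> P Gen_c" for P
    by (metis generator.exhaust)
  then show ?thesis
    by (simp add: mat_rep_def m2_mat_inject coset_eq_iff J_iff)
qed

lemma mat_rep_surj: "range mat_rep = carrier mat2_cubed"
proof
  show "range mat_rep \<subseteq> carrier mat2_cubed"
    by (auto simp: mat2_cubed_def Let_def prod_algebra_simps module_mat_simps mat_rep_def)
  show "carrier mat2_cubed \<subseteq> range mat_rep"
  proof
    fix X :: "'k mat \<times> 'k mat \<times> 'k mat"
    assume X: "X \<in> carrier mat2_cubed"
    obtain X1 X2 X3 where X_eq: "X = (X1, X2, X3)" by (cases X)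
    with X have "X1 \<in> carrier_mat 2 2" "X2 \<in> carrier_mat 2 2" "X3 \<in> carrier_mat 2 2"
      by (simp_all add: mat2_cubed_def Let_def prod_algebra_simps module_mat_simps)
    then obtain M1 M2 M3 where M: "m2_mat M1 = X1" "m2_mat M2 = X2" "m2_mat M3 = X3"
      using m2_mat_surj by metis
    obtain p where "\<And>i. rep i p = (case i of Gen_a \<Rightarrow> M1 | Gen_b \<Rightarrow> M2 | Gen_c \<Rightarrow> M3)"
      using reps_surj by metis
    then have "mat_rep p = X" by (simp add: mat_rep_def M X_eq)
    then show "X \<in> range mat_rep" by blast
  qed
qed

lemma isomorphic_D3: "isomorphic_algebras (D3 \<alpha>\<^sub>1 \<alpha>\<^sub>2) mat2_cubed"
proof -
  define h where "h X = mat_rep (SOME p. coset p = X)" for X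
  have h: "h (coset p) = mat_rep p" for p
    unfolding h_def mat_rep_eq_iff by (rule someI) (rule refl)
  have carrier: "carrier (D3 \<alpha>\<^sub>1 \<alpha>\<^sub>2) = range coset"
    by (simp add: D3_def quot_algebra_simps)
  have "bij_betw h (carrier (D3 \<alpha>\<^sub>1 \<alpha>\<^sub>2)) (carrier mat2_cubed)"
    unfolding bij_betw_def carrier
  proof
    show "inj_on h (range coset)"
      by (auto intro!: inj_onI simp: h mat_rep_eq_iff)
    show "h ` range coset = carrier mat2_cubed"
      by (simp add: image_image h mat_rep_surj)
  qed
  moreover have "h \<in> Ring.ring_hom (D3 \<alpha>\<^sub>1 \<alpha>\<^sub>2) mat2_cubed"
  proof (rule ring_hom_memI)
    show "h X \<in> carrier mat2_cubed" if "X \<in> carrier (D3 \<alpha>\<^sub>1 \<alpha>\<^sub>2)" for X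
      using that mat_rep_surj by (auto simp: carrier h)
  qed (auto simp: carrier, auto simp: h D3_def quot_algebra_simps mat2_cubed_def Let_def prod_algebra_simps
      module_mat_simps mat_rep_def m2_mat_hom)
  moreover have "h (d \<odot>\<^bsub>D3 \<alpha>\<^sub>1 \<alpha>\<^sub>2\<^esub> X) = d \<odot>\<^bsub>mat2_cubed\<^esub> h X" if "X \<in> carrier (D3 \<alpha>\<^sub>1 \<alpha>\<^sub>2)" for d X
    using that
    by (auto simp: carrier)
      (simp add: h D3_def quot_algebra_simps mat2_cubed_def Let_def prod_algebra_simps
        module_mat_simps mat_rep_def m2_mat_hom)
  ultimately show ?thesis
    unfolding isomorphic_algebras_def algebra_iso_def ring_iso_def by blast
qed

end

theorem theorem2p11:
  fixes \<alpha>\<^sub>1 \<alpha>\<^sub>2 :: "'k :: alg_closed_field"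
  assumes "CHAR('k) \<noteq> 2"
  shows "(semisimple (D3 \<alpha>\<^sub>1 \<alpha>\<^sub>2) \<longleftrightarrow> (3 * \<alpha>\<^sub>1 - \<alpha>\<^sub>2) * (\<alpha>\<^sub>1 + \<alpha>\<^sub>2) \<noteq> 0) \<and>
         ((3 * \<alpha>\<^sub>1 - \<alpha>\<^sub>2) * (\<alpha>\<^sub>1 + \<alpha>\<^sub>2) \<noteq> 0 \<longrightarrow> isomorphic_algebras (D3 \<alpha>\<^sub>1 \<alpha>\<^sub>2) mat2_cubed)"
proof -
  obtain r where r: "r * r = \<alpha>\<^sub>1"
    using nth_root_exists[of 2 \<alpha>\<^sub>1] by (auto simp: power2_eq_square)
  show ?thesis
  proof (cases "(3 * \<alpha>\<^sub>1 - \<alpha>\<^sub>2) * (\<alpha>\<^sub>1 + \<alpha>\<^sub>2) = 0")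
    case True
    \<comment> \<open>The factor \<open>3 * \<alpha>\<^sub>1 - \<alpha>\<^sub>2\<close> vanishes in
      the first case and \<open>\<alpha>\<^sub>1 + \<alpha>\<^sub>2\<close> in the second, written
      to match \<open>\<epsilon> = 1\<close> and \<open>\<epsilon> = - 1\<close>.\<close>
    then consider "\<alpha>\<^sub>2 = \<alpha>\<^sub>1 + 2 * 1 * \<alpha>\<^sub>1" | "\<alpha>\<^sub>2 = \<alpha>\<^sub>1 + 2 * (- 1) * \<alpha>\<^sub>1"
      by (auto simp: eq_neg_iff_add_eq_0 add.commute)
    then have "\<not> semisimple (D3 \<alpha>\<^sub>1 \<alpha>\<^sub>2)"
    proof cases
      case 1
      then show ?thesis by (intro not_semisimple_D3[OF r, of 1]) simp_all
    next
      case 2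
      then show ?thesis by (intro not_semisimple_D3[OF r, of "- 1"]) simp_all
    qed
    with True show ?thesis by simp
  next
    case False
    with r interpret D3_nondegenerate \<alpha>\<^sub>1 \<alpha>\<^sub>2 r by unfold_locales
    show ?thesis using False semisimple_D3 isomorphic_D3 by simp
  qed
qed

end
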